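(* Let $T$ and $T'$ be commuting contractions on a complex Hilbert space $\mathcal{H}$ such that $T$ is Harnack dominated by $T'$, and let $\mathcal{H}_i$ and $\mathcal{H}_i'$ be the reducing isometric parts in $\mathcal{H}$ of $T$ and $T'$, respectively. Then: (i) $\mathcal{H}_i'\subset\mathcal{H}_i$ and $T'=T$ on $\mathcal{H}_i'$. (ii) If $\mathcal{H}_i\subset\mathcal{N}(D_{T'})$, then $\mathcal{H}_i'$ reduces $T$. In addition, if $\mathcal{N}(I-S_T)$ reduces $T'$, then $\mathcal{H}_i=\mathcal{H}_i'=\mathcal{N}(I-S_{T'})=\mathcal{N}(I-S_T)$. (iii) If the Harnack operator associated with the pair $(T,T')$ is injective, then $\mathcal{H}_i'$ reduces $T$. (iv) If $T$ and $T'$ are Harnack equivalent, then $\mathcal{H}_i=\mathcal{H}_i'$.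
   Context: A contraction is a bounded linear operator of norm at most $1$; $\mathcal{N}(\cdot)$ denotes the kernel; $\operatorname{Re}A=\frac12(A+A^* )$. Harnack domination: for contractions $T,T'$ on the same Hilbert space, $T$ is Harnack dominated by $T'$ if there is a constant $c\ge 1$ such that $\operatorname{Re}p(T)\le c\,\operatorname{Re}p(T')$ for every analytic polynomial $p$ with $\operatorname{Re}p(z)\ge 0$ for $|z|\le 1$. $T$ and $T'$ are Harnack equivalent if each is Harnack dominated by the other. For a contraction $T$: $D_T=(I-T^*T)^{1/2}$ is the defect operator; $S_T$ is the strong limit of $\{T^{*n}T^n\}_n$ (asymptotic limit); the reducing isometric part of $T$ in $\mathcal{H}$ is the largest closed subspace of $\mathcal{H}$ that reduces $T$ (is invariant under $T$ and $T^*$) and on which $T$ is an isometry. Minimal isometric dilation: $V$ on $\mathcal{K}\supset\mathcal{H}$ is a minimal isometric dilation of $T$ if $V$ is an isometry on $\mathcal{K}=\bigvee_{n\ge 0}V^n\mathcal{H}$ (closed linear span) with $P_{\mathcal{H}}V=TP_{\mathcal{H}}$, where $P_{\mathcal{H}}$ is the orthogonal projection of $\mathcal{K}$ onto $\mathcal{H}$. Let $V\in\mathcal{B}(\mathcal{K})$, $V'\in\mathcal{B}(\mathcal{K}')$ be the minimal isometric dilations of $T$, $T'$. When $T$ is Harnack dominated by $T'$ there is a unique bounded operator $A\in\mathcal{B}(\mathcal{K}',\mathcal{K})$ such that $A(\mathcal{H})\subseteq\mathcal{H}$, $A|_{\mathcal{H}}=I$ and $AV'=VA$; this $A$ is the Harnack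 operator associated with $(T,T')$. *)

theory Defs
  imports "HOL-Analysis.Analysis" "HOL-Computational_Algebra.Polynomial"
begin

text \<open>
  Complex Hilbert spaces: complete normed spaces whose norm comes from a complex inner product,
  linear in the first argument. The class extends \<^class>\<open>banach\<close>, so completeness and the
  real normed-space structure are those of the library. Definiteness of the inner product is
  a consequence of definiteness of the norm.
\<close>

class complex_hilbert_space = banach +
  fixes scaleC :: "complex \<Rightarrow> 'a \<Rightarrow> 'a"  (infixr \<open>*\<^sub>C\<close> 75)
    and cinner :: "'a \<Rightarrow> 'a \<Rightarrow> complex"
  assumes scaleC_add_right: "a *\<^sub>C (x + y) = a *\<^sub>C x + a *\<^sub>C y"
    and scaleC_add_left: "(a + b) *\<^sub>C x = a *\<^sub>C x + b *\<^sub>C x"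
    and scaleC_scaleC: "a *\<^sub>C b *\<^sub>C x = (a * b) *\<^sub>C x"
    and scaleC_one: "1 *\<^sub>C x = x"
    and scaleR_scaleC: "r *\<^sub>R x = complex_of_real r *\<^sub>C x"
    and cinner_commute: "cinner x y = cnj (cinner y x)"
    and cinner_add_left: "cinner (x + y) z = cinner x z + cinner y z"
    and cinner_scaleC_left: "cinner (a *\<^sub>C x) y = a * cinner x y"
    and cinner_ge_zero: "0 \<le> Re (cinner x x)"
    and norm_eq_sqrt_cinner: "norm x = sqrt (Re (cinner x x))"

instantiation complex :: complex_hilbert_space
begin

definition "scaleC_complex = ((*) :: complex \<Rightarrow> complex \<Rightarrow> complex)"
definition "cinner_complex = (\<lambda>x y :: complex. x * cnj y)"

instance
  by standard
    (simp_all add: scaleC_complex_def cinner_complex_def algebra_simps scaleR_conv_of_real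
      cmod_def power2_eq_square)

end

definition closed_csubspace :: "'a::complex_hilbert_space set \<Rightarrow> bool" where
  "closed_csubspace M \<longleftrightarrow> subspace M \<and> (\<forall>c. \<forall>x\<in>M. c *\<^sub>C x \<in> M) \<and> closed M"

definition closed_cspan :: "'a::complex_hilbert_space set \<Rightarrow> 'a set" where
  "closed_cspan S = \<Inter> {M. closed_csubspace M \<and> S \<subseteq> M}"

definition bounded_clinear ::
    "('a::complex_hilbert_space \<Rightarrow> 'b::complex_hilbert_space) \<Rightarrow> bool" where
  "bounded_clinear A \<longleftrightarrow> bounded_linear A \<and> (\<forall>c x. A (c *\<^sub>C x) = c *\<^sub>C A x)"

definition contraction :: "('a::complex_hilbert_space \<Rightarrow> 'b::complex_hilbert_space) \<Rightarrow> bool" where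
  "contraction T \<longleftrightarrow> bounded_clinear T \<and> onorm T \<le> 1"

definition isometric_op :: "('a::complex_hilbert_space \<Rightarrow> 'b::complex_hilbert_space) \<Rightarrow> bool" where
  "isometric_op V \<longleftrightarrow> bounded_clinear V \<and> (\<forall>x. norm (V x) = norm x)"

definition null_space :: "('a::complex_hilbert_space \<Rightarrow> 'b::complex_hilbert_space) \<Rightarrow> 'a set" where
  "null_space A = {x. A x = 0}"

definition cadjoint ::
    "('a::complex_hilbert_space \<Rightarrow> 'b::complex_hilbert_space) \<Rightarrow> 'b \<Rightarrow> 'a" where
  "cadjoint A = (THE B. \<forall>x y. cinner (A x) y = cinner x (B y))"

definition positive_op :: "('a::complex_hilbert_space \<Rightarrow> 'a) \<Rightarrow> bool" where
  "positive_op A \<longleftrightarrow>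
     bounded_clinear A \<and> (\<forall>x. cinner (A x) x \<in> \<real> \<and> 0 \<le> Re (cinner (A x) x))"

definition op_le ::
    "('a::complex_hilbert_space \<Rightarrow> 'a) \<Rightarrow> ('a \<Rightarrow> 'a) \<Rightarrow> bool"  (infix \<open>\<le>\<^sub>o\<^sub>p\<close> 50) where
  "A \<le>\<^sub>o\<^sub>p B \<longleftrightarrow> positive_op (\<lambda>x. B x - A x)"

text \<open>A positive operator has exactly one positive square root, so the choice is immaterial.\<close>

definition op_sqrt :: "('a::complex_hilbert_space \<Rightarrow> 'a) \<Rightarrow> 'a \<Rightarrow> 'a" where
  "op_sqrt A = (SOME B. positive_op B \<and> B \<circ> B = A)"

definition defect_op :: "('a::complex_hilbert_space \<Rightarrow> 'a) \<Rightarrow> 'a \<Rightarrow> 'a" where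
  "defect_op T = op_sqrt (\<lambda>x. x - cadjoint T (T x))"

definition asymptotic_limit :: "('a::complex_hilbert_space \<Rightarrow> 'a) \<Rightarrow> 'a \<Rightarrow> 'a" where
  "asymptotic_limit T = (\<lambda>x. lim (\<lambda>n. (cadjoint T ^^ n) ((T ^^ n) x)))"

definition re_op :: "('a::complex_hilbert_space \<Rightarrow> 'a) \<Rightarrow> 'a \<Rightarrow> 'a" where
  "re_op A = (\<lambda>x. (1/2) *\<^sub>R (A x + cadjoint A x))"

definition poly_op :: "complex poly \<Rightarrow> ('a::complex_hilbert_space \<Rightarrow> 'a) \<Rightarrow> 'a \<Rightarrow> 'a" where
  "poly_op p T = (\<lambda>x. \<Sum>i\<le>degree p. coeff p i *\<^sub>C (T ^^ i) x)"

definition harnack_dominated ::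
    "('a::complex_hilbert_space \<Rightarrow> 'a) \<Rightarrow> ('a \<Rightarrow> 'a) \<Rightarrow> bool" where
  "harnack_dominated T T' \<longleftrightarrow>
     (\<exists>c\<ge>1. \<forall>p. (\<forall>z. cmod z \<le> 1 \<longrightarrow> 0 \<le> Re (poly p z)) \<longrightarrow>
        re_op (poly_op p T) \<le>\<^sub>o\<^sub>p (\<lambda>x. c *\<^sub>R re_op (poly_op p T') x))"

definition harnack_equivalent ::
    "('a::complex_hilbert_space \<Rightarrow> 'a) \<Rightarrow> ('a \<Rightarrow> 'a) \<Rightarrow> bool" where
  "harnack_equivalent T T' \<longleftrightarrow> harnack_dominated T T' \<and> harnack_dominated T' T"

definition reduces :: "'a::complex_hilbert_space set \<Rightarrow> ('a \<Rightarrow> 'a) \<Rightarrow> bool" where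
  "reduces M T \<longleftrightarrow> closed_csubspace M \<and> T ` M \<subseteq> M \<and> cadjoint T ` M \<subseteq> M"

definition reducing_isometric_part ::
    "('a::complex_hilbert_space \<Rightarrow> 'a) \<Rightarrow> 'a set" where
  "reducing_isometric_part T =
     (GREATEST M. reduces M T \<and> (\<forall>x\<in>M. norm (T x) = norm x))"

text \<open>
  The inclusion of \<open>H\<close> into the dilation space \<open>K\<close> is an isometric embedding \<open>J\<close>. The orthogonal
  projection of \<open>K\<close> onto \<open>J(H)\<close> is \<open>J J\<^sup>*\<close>, so the projection read as a map from \<open>K\<close> to \<open>H\<close> is
  \<open>J\<^sup>*\<close>, and the last clause says \<open>P\<^sub>H V = T P\<^sub>H\<close>.
\<close>

definition minimal_isometric_dilation ::
    "('h::complex_hilbert_space \<Rightarrow> 'h) \<Rightarrow> ('h \<Rightarrow> 'k::complex_hilbert_space) \<Rightarrow> ('k \<Rightarrow> 'k) \<Rightarrow> bool"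
  where
  "minimal_isometric_dilation T J V \<longleftrightarrow>
     isometric_op J \<and> isometric_op V \<and>
     closed_cspan (\<Union>n. (V ^^ n) ` range J) = UNIV \<and>
     cadjoint J \<circ> V = T \<circ> cadjoint J"

text \<open>
  With \<open>H\<close> embedded in \<open>K'\<close> by \<open>J'\<close> and in \<open>K\<close> by \<open>J\<close>, the equation \<open>A \<circ> J' = J\<close> expresses both
  \<open>A(H) \<subseteq> H\<close> and that \<open>A\<close> is the identity on \<open>H\<close>. Minimality of the dilations makes such an \<open>A\<close>
  unique.
\<close>

definition harnack_operator ::
    "('h::complex_hilbert_space \<Rightarrow> 'k::complex_hilbert_space) \<Rightarrow> ('k \<Rightarrow> 'k) \<Rightarrow>
     ('h \<Rightarrow> 'l::complex_hilbert_space) \<Rightarrow> ('l \<Rightarrow> 'l) \<Rightarrow> ('l \<Rightarrow> 'k) \<Rightarrow> bool" where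
  "harnack_operator J V J' V' A \<longleftrightarrow> bounded_clinear A \<and> A \<circ> J' = J \<and> A \<circ> V' = V \<circ> A"

end

theory Submission imports Defs begin

text \<open>
  Averaging rotated Fejer polynomials over roots of unity upgrades Harnack domination of \<open>T\<close> by \<open>T'\<close>
  to domination of the operator Toeplitz forms, i.e. to
  \<open>\<parallel>\<Sum>j. V\<^sup>j (h j)\<parallel>\<^sup>2 \<le> c \<parallel>\<Sum>j. V'\<^sup>j (h j)\<parallel>\<^sup>2\<close> without constructing the dilations \<open>V\<close>, \<open>V'\<close>. Two
  vectors suffice to see that \<open>T x = T' x\<close> whenever \<open>\<parallel>T' x\<parallel> = \<parallel>x\<parallel>\<close>. On the reducing isometric part of
  \<open>T'\<close>, commutation then gives \<open>T\<^sup>* h = T\<^sup>* T'\<^sup>* T h = T'\<^sup>* T\<^sup>* T h = T'\<^sup>* h\<close>, so this part reduces \<open>T\<close>; parts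
  (i), (iii), (iv) and the first half of (ii) follow. For the second half of (ii), a telescoping
  argument applied to the forms shows that \<open>T\<close> and \<open>T'\<close> agree on every subspace invariant under both on
  which \<open>T\<close> is isometric.
\<close>

section \<open>Inner products and adjoints\<close>

lemma cinner_add_right: "cinner x (y + z) = cinner x y + cinner x z"
  for x :: "'a::complex_hilbert_space"
  by (metis cinner_add_left cinner_commute complex_cnj_add)

lemma cinner_scaleC_right: "cinner x (a *\<^sub>C y) = cnj a * cinner x y"
  for x :: "'a::complex_hilbert_space"
  by (metis cinner_commute cinner_scaleC_left complex_cnj_mult)

lemma cinner_scaleR_left: "cinner (r *\<^sub>R x) y = of_real r * cinner x y"
  for x :: "'a::complex_hilbert_space"
  by (simp add: scaleR_scaleC cinner_scaleC_left)

lemma cinner_scaleR_right: "cinner x (r *\<^sub>R y) = of_real r * cinner x y"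
  for x :: "'a::complex_hilbert_space"
  by (simp add: scaleR_scaleC cinner_scaleC_right)

lemma cinner_zero_left [simp]: "cinner 0 y = 0" for y :: "'a::complex_hilbert_space"
  using cinner_add_left[of 0 0 y] by simp

lemma cinner_zero_right [simp]: "cinner y 0 = 0" for y :: "'a::complex_hilbert_space"
  using cinner_add_right[of y 0 0] by simp

lemma cinner_minus_left: "cinner (- x) y = - cinner x y" for x :: "'a::complex_hilbert_space"
  using cinner_add_left[of x "- x" y] by (simp add: add_eq_0_iff)

lemma cinner_minus_right: "cinner x (- y) = - cinner x y" for x :: "'a::complex_hilbert_space"
  using cinner_add_right[of x y "- y"] by (simp add: add_eq_0_iff)

lemma cinner_diff_left: "cinner (x - y) z = cinner x z - cinner y z"
  for x :: "'a::complex_hilbert_space"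
  using cinner_add_left[of x "- y" z] by (simp add: cinner_minus_left)

lemma cinner_diff_right: "cinner x (y - z) = cinner x y - cinner x z"
  for x :: "'a::complex_hilbert_space"
  using cinner_add_right[of x y "- z"] by (simp add: cinner_minus_right)

lemma cinner_sum_left: "cinner (sum f S) y = (\<Sum>i\<in>S. cinner (f i) y)"
  for y :: "'a::complex_hilbert_space"
  by (induction S rule: infinite_finite_induct) (simp_all add: cinner_add_left)

lemma cinner_sum_right: "cinner y (sum f S) = (\<Sum>i\<in>S. cinner y (f i))"
  for y :: "'a::complex_hilbert_space"
  by (induction S rule: infinite_finite_induct) (simp_all add: cinner_add_right)

lemma scaleC_zero_right: "a *\<^sub>C (0::'a::complex_hilbert_space) = 0"
  using scaleC_add_right[of a "0::'a" 0] by simp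

lemma scaleC_sum_right: "a *\<^sub>C sum f S = (\<Sum>i\<in>S. a *\<^sub>C (f i :: 'a::complex_hilbert_space))"
  by (induction S rule: infinite_finite_induct) (simp_all add: scaleC_add_right scaleC_zero_right)

lemma Re_cinner_commute: "Re (cinner x y) = Re (cinner y x)" for x :: "'a::complex_hilbert_space"
  using arg_cong[OF cinner_commute[of x y], of Re] by simp

lemma cinner_self: "cinner x x = of_real ((norm x)\<^sup>2)" for x :: "'a::complex_hilbert_space"
proof -
  have "Im (cinner x x) = 0"
    using arg_cong[OF cinner_commute[of x x], of Im] by simp
  then show ?thesis
    by (simp add: complex_eq_iff norm_eq_sqrt_cinner cinner_ge_zero)
qed

lemma norm_add_sq: "(norm (x + y))\<^sup>2 = (norm x)\<^sup>2 + 2 * Re (cinner x y) + (norm y)\<^sup>2"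
  for x :: "'a::complex_hilbert_space"
proof -
  have "(norm (x + y))\<^sup>2 = Re (cinner (x + y) (x + y))" by (simp add: cinner_self)
  also have "\<dots> = (norm x)\<^sup>2 + 2 * Re (cinner x y) + (norm y)\<^sup>2"
    using Re_cinner_commute[of y x] by (simp add: cinner_add_left cinner_add_right cinner_self[of x] cinner_self[of y])
  finally show ?thesis .
qed

lemma norm_diff_sq: "(norm (x - y))\<^sup>2 = (norm x)\<^sup>2 - 2 * Re (cinner x y) + (norm y)\<^sup>2"
  for x :: "'a::complex_hilbert_space"
  using norm_add_sq[of x "- y"] by (simp add: cinner_minus_right)

lemma Re_cinner_le: "Re (cinner x y) \<le> norm x * norm y" for x :: "'a::complex_hilbert_space"
proof (cases "x = 0 \<or> y = 0")
  case False
  have "0 \<le> (norm (norm y *\<^sub>R x - norm x *\<^sub>R y))\<^sup>2" by simp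
  also have "\<dots> = 2 * (norm x * norm y) * (norm x * norm y - Re (cinner x y))"
    unfolding norm_diff_sq
    by (simp add: cinner_scaleR_left cinner_scaleR_right power2_eq_square algebra_simps)
  finally have "0 \<le> 2 * (norm x * norm y) * (norm x * norm y - Re (cinner x y))" .
  moreover have "0 < 2 * (norm x * norm y)"
    using False by simp
  ultimately have "0 \<le> norm x * norm y - Re (cinner x y)"
    by (metis not_le mult_pos_neg)
  then show ?thesis by simp
qed auto

lemma bounded_linear_Re_cinner: "bounded_linear (\<lambda>x. Re (cinner x y))"
  for y :: "'a::complex_hilbert_space"
proof (rule bounded_linear_intro[where K = "norm y"])
  fix x
  show "norm (Re (cinner x y)) \<le> norm x * norm y"
    using Re_cinner_le[of x y] Re_cinner_le[of "- x" y] by (simp add: cinner_minus_left abs_le_iff)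
qed (simp_all add: cinner_add_left cinner_scaleR_left)

text \<open>Replaces dividing by \<open>N\<close> and letting \<open>N\<close> tend to infinity: for
  the Riesz minimiser, the Fejer averages and the telescoping estimate.\<close>

lemma affine_le_const_imp_nonpos:
  fixes a b :: real
  assumes "\<And>N::nat. N \<ge> n \<Longrightarrow> real N * a \<le> b"
  shows "a \<le> 0"
proof (rule ccontr)
  assume "\<not> a \<le> 0"
  then obtain N :: nat where "b < real N * a"
    using reals_Archimedean3[of a] by (auto simp: not_le)
  moreover have "real N * a \<le> real (max N n) * a"
    using \<open>\<not> a \<le> 0\<close> by (intro mult_right_mono) auto
  ultimately show False
    using assms[of "max N n"] by simp
qed

section \<open>Riesz representation and adjoints\<close>

text \<open>The representing vector is the minimiser of \<open>\<parallel>x\<parallel>\<^sup>2 - 2 g x\<close>.\<close>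

lemma riesz_real:
  fixes g :: "'a::complex_hilbert_space \<Rightarrow> real"
  assumes g: "bounded_linear g"
  shows "\<exists>z. \<forall>x. g x = Re (cinner x z)"
proof -
  interpret g: bounded_linear g by (rule g)
  define \<phi> where "\<phi> x = (norm x)\<^sup>2 - 2 * g x" for x
  obtain K where K: "\<And>x. norm (g x) \<le> norm x * K"
    using g.bounded by blast
  have lower: "- K\<^sup>2 \<le> \<phi> x" for x
  proof -
    have "0 \<le> (norm x - K)\<^sup>2" by simp
    then show ?thesis
      using K[of x] by (simp add: \<phi>_def power2_eq_square algebra_simps abs_le_iff)
  qed
  define d where "d = Inf (range \<phi>)"
  have bdd: "bdd_below (range \<phi>)"
    by (rule bdd_belowI2) (rule lower)
  have d_le: "d \<le> \<phi> x" for x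
    unfolding d_def by (rule cInf_lower[OF _ bdd]) simp
  have "\<exists>x. \<phi> x < d + inverse (real (Suc n))" for n
    using cInf_lessD[of "range \<phi>" "d + inverse (real (Suc n))"] by (auto simp: d_def)
  then obtain X where X: "\<And>n. \<phi> (X n) < d + inverse (real (Suc n))"
    by metis
  \<comment> \<open>Parallelogram law, with the value at the midpoint bounded below by
    \<open>d\<close>; it makes the minimising sequence Cauchy.\<close>
  have mid: "(norm (x - y))\<^sup>2 \<le> 2 * \<phi> x + 2 * \<phi> y - 4 * d" for x y
  proof -
    have "\<phi> ((1/2) *\<^sub>R (x + y)) = (1/4) * (norm (x + y))\<^sup>2 - g x - g y"
      by (simp add: \<phi>_def g.add g.scaleR power_divide) argo
    then show ?thesis
      using d_le[of "(1/2) *\<^sub>R (x + y)"] norm_add_sq[of x y] norm_diff_sq[of x y]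
      unfolding \<phi>_def[of x] \<phi>_def[of y] by argo
  qed
  have "Cauchy X"
  proof (rule metric_CauchyI)
    fix e :: real assume "0 < e"
    then obtain M where M: "inverse (real (Suc M)) < e\<^sup>2 / 4"
      using reals_Archimedean[of "e\<^sup>2 / 4"] by auto
    have "dist (X m) (X n) < e" if "m \<ge> M" "n \<ge> M" for m n
    proof -
      have "\<phi> (X k) < d + e\<^sup>2 / 4" if "k \<ge> M" for k
      proof -
        have "inverse (real (Suc k)) \<le> inverse (real (Suc M))"
          using that by (intro le_imp_inverse_le) auto
        then show ?thesis using X[of k] M by linarith
      qed
      from this[OF \<open>m \<ge> M\<close>] this[OF \<open>n \<ge> M\<close>] have "(norm (X m - X n))\<^sup>2 < e\<^sup>2"
        using mid[of "X m" "X n"] by linarith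
      then show ?thesis
        using \<open>0 < e\<close> by (simp add: dist_norm power2_less_imp_less)
    qed
    then show "\<exists>M. \<forall>m\<ge>M. \<forall>n\<ge>M. dist (X m) (X n) < e" by blast
  qed
  then obtain z where z: "X \<longlonglongrightarrow> z"
    using Cauchy_convergent_iff convergent_def by blast
  have "(\<lambda>n. \<phi> (X n)) \<longlonglongrightarrow> \<phi> z"
    unfolding \<phi>_def by (intro tendsto_intros z g.tendsto)
  moreover have "(\<lambda>n. d + inverse (real (Suc n))) \<longlonglongrightarrow> d + 0"
    by (intro tendsto_intros LIMSEQ_inverse_real_of_nat)
  ultimately have "\<phi> z \<le> d + 0"
    by (rule LIMSEQ_le) (use X in \<open>auto intro: less_imp_le\<close>)
  then have min: "\<phi> z \<le> \<phi> x" for x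
    using d_le[of x] by simp
  \<comment> \<open>Comparing \<open>z\<close> with \<open>z + x/N\<close> bounds the first-order
    term by a second-order one; \<open>x\<close> and \<open>-x\<close> together then give
    equality.\<close>
  have le: "2 * (g x - Re (cinner x z)) \<le> 0" for x
  proof (rule affine_le_const_imp_nonpos[where n = 1])
    fix N :: nat assume "1 \<le> N"
    then have N: "real N > 0" by simp
    have "\<phi> z \<le> \<phi> (z + (1 / real N) *\<^sub>R x)" by (rule min)
    then have "2 * (g x - Re (cinner x z)) / real N \<le> (norm x)\<^sup>2 / (real N)\<^sup>2"
      using Re_cinner_commute[of x z]
      by (simp add: \<phi>_def norm_add_sq g.add g.scaleR cinner_scaleR_right power_divide
          diff_divide_distrib)
    then have "(2 * (g x - Re (cinner x z)) / real N) * (real N)\<^sup>2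
        \<le> ((norm x)\<^sup>2 / (real N)\<^sup>2) * (real N)\<^sup>2"
      by (rule mult_right_mono) simp
    then show "real N * (2 * (g x - Re (cinner x z))) \<le> (norm x)\<^sup>2"
      using N by (simp add: power2_eq_square mult_ac)
  qed
  have "g x = Re (cinner x z)" for x
    using le[of x] le[of "- x"] by (simp add: cinner_minus_left g.neg)
  then show ?thesis by blast
qed

lemma cinner_eqI:
  fixes y z :: "'a::complex_hilbert_space"
  assumes "\<And>x. cinner x y = cinner x z"
  shows "y = z"
proof -
  have "cinner (y - z) (y - z) = 0"
    using assms[of "y - z"] by (simp add: cinner_diff_right)
  then show ?thesis by (simp add: cinner_self)
qed

text \<open>As \<open>cadjoint\<close> is a definite description, existence (Riesz for the real
  part) and uniqueness must both be supplied.\<close>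

lemma cinner_cadjoint:
  fixes A :: "'a::complex_hilbert_space \<Rightarrow> 'b::complex_hilbert_space"
  assumes A: "bounded_clinear A"
  shows "cinner (A x) y = cinner x (cadjoint A y)"
proof -
  interpret A: bounded_linear A using A by (simp add: bounded_clinear_def)
  have AC: "A (c *\<^sub>C x) = c *\<^sub>C A x" for c x using A by (simp add: bounded_clinear_def)
  have "\<exists>z. \<forall>x. cinner (A x) y = cinner x z" for y
  proof -
    have "bounded_linear (\<lambda>x. Re (cinner (A x) y))"
      by (rule bounded_linear_compose[OF bounded_linear_Re_cinner]) (rule A.bounded_linear_axioms)
    then obtain z where z: "\<And>x. Re (cinner (A x) y) = Re (cinner x z)"
      using riesz_real by blast
    \<comment> \<open>Multiplying \<open>x\<close> by the imaginary unit recovers the imaginary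
      parts.\<close>
    have "cinner (A x) y = cinner x z" for x
      using z[of x] z[of "\<i> *\<^sub>C x"] by (simp add: AC cinner_scaleC_left complex_eq_iff)
    then show ?thesis by blast
  qed
  then obtain B where B: "\<And>x y. cinner (A x) y = cinner x (B y)" by metis
  have "cadjoint A = B"
    unfolding cadjoint_def
  proof (rule the_equality)
    fix C assume C: "\<forall>x y. cinner (A x) y = cinner x (C y)"
    show "C = B"
      by (rule ext, rule cinner_eqI) (metis B C)
  qed (use B in blast)
  then show ?thesis by (simp add: B)
qed

text \<open>Turns the operator inequality in \<open>harnack_dominated\<close> into a scalar one free
  of adjoints.\<close>

lemma Re_cinner_re_op:
  fixes A :: "'a::complex_hilbert_space \<Rightarrow> 'a"
  assumes "bounded_clinear A"
  shows "Re (cinner (re_op A x) x) = Re (cinner (A x) x)"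
proof -
  have "Re (cinner (cadjoint A x) x) = Re (cinner (A x) x)"
    by (metis Re_cinner_commute assms cinner_cadjoint)
  then show ?thesis
    by (simp add: re_op_def cinner_scaleR_left cinner_add_left)
qed

lemma bounded_clinear_funpow:
  fixes T :: "'a::complex_hilbert_space \<Rightarrow> 'a"
  assumes "bounded_clinear T"
  shows "bounded_clinear (T ^^ n)"
proof (induction n)
  case 0
  then show ?case by (simp add: bounded_clinear_def id_def)
next
  case (Suc n)
  have "bounded_linear (\<lambda>x. T ((T ^^ n) x))"
    using assms Suc unfolding bounded_clinear_def
    by (blast intro: bounded_linear_compose[where f = T and g = "T ^^ n"])
  moreover have "T ((T ^^ n) (c *\<^sub>C x)) = c *\<^sub>C T ((T ^^ n) x)" for c x
    using assms Suc unfolding bounded_clinear_def by metis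
  ultimately show ?case
    by (simp add: bounded_clinear_def comp_def)
qed

lemma bounded_linear_scaleC: "bounded_linear (\<lambda>x::'a::complex_hilbert_space. a *\<^sub>C x)"
proof (rule bounded_linear_intro[where K = "cmod a"])
  fix x :: 'a
  have "(norm (a *\<^sub>C x))\<^sup>2 = Re (cinner (a *\<^sub>C x) (a *\<^sub>C x))" by (simp add: cinner_self)
  also have "\<dots> = Re (a * cnj a * cinner x x)"
    unfolding cinner_scaleC_left cinner_scaleC_right by (simp only: mult.assoc mult.left_commute)
  also have "\<dots> = Re (of_real ((norm x * cmod a)\<^sup>2))"
    unfolding complex_norm_square[symmetric] cinner_self
    by (simp only: power_mult_distrib of_real_mult of_real_power mult.commute)
  also have "\<dots> = (norm x * cmod a)\<^sup>2" by (rule Re_complex_of_real)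
  finally show "norm (a *\<^sub>C x) \<le> norm x * cmod a" by simp
qed (simp_all add: scaleC_add_right scaleR_scaleC scaleC_scaleC mult.commute)

lemma bounded_clinear_poly_op:
  fixes T :: "'a::complex_hilbert_space \<Rightarrow> 'a"
  assumes "bounded_clinear T"
  shows "bounded_clinear (poly_op p T)"
proof -
  have "bounded_linear (poly_op p T)"
    unfolding poly_op_def
    by (intro bounded_linear_sum bounded_linear_compose[OF bounded_linear_scaleC])
      (use bounded_clinear_funpow[OF assms] in \<open>simp add: bounded_clinear_def\<close>)
  moreover have "poly_op p T (c *\<^sub>C x) = c *\<^sub>C poly_op p T x" for c x
    using bounded_clinear_funpow[OF assms]
    by (simp add: poly_op_def bounded_clinear_def scaleC_sum_right scaleC_scaleC mult.commute)
  ultimately show ?thesis by (simp add: bounded_clinear_def)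
qed


section \<open>Domination of Toeplitz forms\<close>

text \<open>If \<open>V\<close> is an isometric dilation of \<open>T\<close>, this is \<open>\<parallel>\<Sum>j<n. V\<^sup>j (h j)\<parallel>\<^sup>2\<close>.\<close>

definition toeplitz_form ::
    "('a::complex_hilbert_space \<Rightarrow> 'a) \<Rightarrow> (nat \<Rightarrow> 'a) \<Rightarrow> nat \<Rightarrow> real" where
  "toeplitz_form T h n =
     (\<Sum>j<n. (norm (h j))\<^sup>2) + 2 * (\<Sum>j<n. \<Sum>i<j. Re (cinner ((T ^^ (j - i)) (h j)) (h i)))"

text \<open>On the unit circle the polynomial with these coefficients has real part
  \<open>|\<Sum>k<N. z^k|^2\<close>, which is \<open>N\<close> times the Fejer kernel; weights are
  doubled for \<open>k > 0\<close> because only the analytic half is kept.\<close>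

definition fejer_coeff :: "nat \<Rightarrow> nat \<Rightarrow> real" where
  "fejer_coeff N k = (if k = 0 then real N else 2 * (real N - real k))"

definition fejer_poly :: "nat \<Rightarrow> complex \<Rightarrow> complex poly" where
  "fejer_poly N w = (\<Sum>k<N. monom (of_real (fejer_coeff N k) * w ^ k) k)"

lemma coeff_fejer_poly:
  "coeff (fejer_poly N w) k = (if k < N then of_real (fejer_coeff N k) * w ^ k else 0)"
  by (simp add: fejer_poly_def coeff_sum)

text \<open>The lower bound makes the induction work: \<open>S (N + 1) = 1 + z S N\<close> for the geometric sums.\<close>

lemma fejer_sum_ge:
  assumes z: "cmod z \<le> 1"
  shows "(cmod (\<Sum>k<N. z ^ k))\<^sup>2 \<le> (\<Sum>k<N. fejer_coeff N k * Re (z ^ k))"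
proof (induction N)
  case (Suc N)
  define S where "S = (\<Sum>k<N. z ^ k)"
  have "(\<Sum>k<Suc N. fejer_coeff (Suc N) k * Re (z ^ k))
      = real (Suc N) + (\<Sum>k<N. 2 * (real N - real k) * Re (z ^ Suc k))"
    unfolding sum.lessThan_Suc_shift by (simp add: fejer_coeff_def)
  \<comment> \<open>The constant term has weight \<open>N\<close>, not \<open>2 * N\<close>, so it
    is peeled off first, which needs \<open>N = Suc M\<close>.\<close>
  moreover have "(\<Sum>k<N. fejer_coeff N k * Re (z ^ k)) + 2 * Re (z * S)
      = real N + (\<Sum>k<N. 2 * (real N - real k) * Re (z ^ Suc k))"
  proof (cases N)
    case (Suc M)
    have "(\<Sum>k<N. 2 * (real N - real k) * Re (z ^ Suc k))
        = (\<Sum>k<N. 2 * (real M - real k) * Re (z ^ Suc k)) + 2 * Re (z * S)"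
      by (simp add: S_def Suc sum_distrib_left algebra_simps flip: sum.distrib)
    moreover have "(\<Sum>k<N. 2 * (real M - real k) * Re (z ^ Suc k))
        = (\<Sum>k<M. 2 * (real M - real k) * Re (z ^ Suc k))"
      by (simp add: Suc)
    moreover have "(\<Sum>k<N. fejer_coeff N k * Re (z ^ k))
        = real N + (\<Sum>k<M. 2 * (real M - real k) * Re (z ^ Suc k))"
      unfolding Suc sum.lessThan_Suc_shift by (simp add: fejer_coeff_def)
    ultimately show ?thesis by simp
  qed (simp add: S_def)
  ultimately have rec: "(\<Sum>k<Suc N. fejer_coeff (Suc N) k * Re (z ^ k))
      = 1 + 2 * Re (z * S) + (\<Sum>k<N. fejer_coeff N k * Re (z ^ k))"
    by simp
  have "(\<Sum>k<Suc N. z ^ k) = 1 + z * S"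
    unfolding sum.lessThan_Suc_shift by (simp add: S_def sum_distrib_left)
  then have "(cmod (\<Sum>k<Suc N. z ^ k))\<^sup>2 = 1 + 2 * Re (z * S) + (cmod (z * S))\<^sup>2"
    unfolding cmod_power2 by (simp add: power2_eq_square algebra_simps)
  \<comment> \<open>The only loss in the induction; on the unit circle there is none.\<close>
  moreover have "(cmod (z * S))\<^sup>2 \<le> (cmod S)\<^sup>2"
    using z by (intro power_mono) (auto simp: norm_mult mult_left_le_one_le)
  ultimately show ?case
    using rec Suc[folded S_def] by linarith
qed simp

lemma Re_poly_fejer_poly_nonneg:
  assumes "cmod w = 1" and "cmod z \<le> 1"
  shows "0 \<le> Re (poly (fejer_poly N w) z)"
proof -
  have "Re (poly (fejer_poly N w) z) = (\<Sum>k<N. fejer_coeff N k * Re ((w * z) ^ k))"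
    by (simp add: fejer_poly_def poly_sum poly_monom power_mult_distrib mult.assoc)
  also have "\<dots> \<ge> (cmod (\<Sum>k<N. (w * z) ^ k))\<^sup>2"
    using assms by (intro fejer_sum_ge) (simp add: norm_mult)
  finally show ?thesis
    by (rule order_trans[OF zero_le_power2])
qed

lemma poly_op_eq_sum:
  assumes "\<And>k. k \<ge> N \<Longrightarrow> coeff p k = 0"
  shows "poly_op p T x = (\<Sum>k<N. coeff p k *\<^sub>C (T ^^ k) x)"
proof -
  have zero: "(0::complex) *\<^sub>C y = 0" for y :: 'a
    using scaleC_add_left[of 0 0 y] by simp
  have "poly_op p T x = (\<Sum>k\<in>{..degree p} \<union> {..<N}. coeff p k *\<^sub>C (T ^^ k) x)"
    unfolding poly_op_def
    by (rule sum.mono_neutral_left) (auto simp: coeff_eq_0 zero)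
  also have "\<dots> = (\<Sum>k<N. coeff p k *\<^sub>C (T ^^ k) x)"
    by (rule sum.mono_neutral_right) (auto simp: assms zero)
  finally show ?thesis .
qed

text \<open>A geometric sum in an \<open>M\<close>-th root of unity \<open>q\<close>; distinct
  \<open>a\<close> and \<open>b\<close> differ by less than \<open>M\<close>, so \<open>q\<close> is
  not 1.\<close>

lemma sum_roots_of_unity:
  fixes a b M :: nat
  assumes "a < M" "b < M"
  defines "w \<equiv> \<lambda>s::nat. cis (2 * pi * real s / real M)"
  shows "(\<Sum>s<M. w s ^ a * cnj (w s) ^ b) = (if a = b then of_nat M else 0)"
proof -
  define q where "q = cis (2 * pi * (real a - real b) / real M)"
  have pow: "w s ^ a * cnj (w s) ^ b = q ^ s" for s
    by (simp add: w_def q_def Complex.DeMoivre cis_cnj cis_mult algebra_simps diff_divide_distrib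
        add_divide_distrib)
  show ?thesis
  proof (cases "a = b")
    case True
    then show ?thesis unfolding pow by (simp add: q_def)
  next
    case False
    have M: "real M > 0" using assms(1) by simp
    have "q ^ M = cis (2 * pi * (real a - real b))"
      using M by (simp add: q_def Complex.DeMoivre)
    also have "\<dots> = 1"
      using cis_multiple_2pi[of "real a - real b"] by simp
    finally have qM: "q ^ M = 1" .
    have "q \<noteq> 1"
    proof
      assume "q = 1"
      then have "cos (2 * pi * (real a - real b) / real M) = 1"
        by (simp add: q_def complex_eq_iff)
      then obtain k :: int where "2 * pi * (real a - real b) / real M = of_int k * 2 * pi"
        unfolding cos_one_2pi_int by auto
      then have "2 * pi * (real a - real b) = 2 * pi * (of_int k * real M)"
        using M by (simp add: divide_eq_eq mult_ac)
      then have "real a - real b = of_int k * real M" by simp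
      then have "of_int (int a - int b) = (of_int (k * int M) :: real)" by simp
      then have eq: "int a - int b = k * int M" by (simp only: of_int_eq_iff)
      have "k \<noteq> 0" using False eq by auto
      then have "int M \<le> \<bar>k * int M\<bar>"
        using assms(1) by (simp add: abs_mult)
      then show False using eq assms by linarith
    qed
    then show ?thesis
      unfolding pow using False qM by (simp add: sum_gp_strict)
  qed
qed

text \<open>
  Averaging over the \<open>M\<close>-th roots of unity \<open>w\<close> the quadratic form of the \<open>w\<close>-rotated Fejer
  polynomial at \<open>\<Sum>j. w\<^sup>-\<^sup>j (h j)\<close> leaves the Toeplitz form with Fejer weights.
\<close>

lemma average_fejer_form:
  fixes T :: "'a::complex_hilbert_space \<Rightarrow> 'a" and h :: "nat \<Rightarrow> 'a"
  assumes T: "bounded_clinear T" and "n \<le> N"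
  defines "M \<equiv> N + n"
  defines "w \<equiv> \<lambda>s::nat. cis (2 * pi * real s / real M)"
  defines "g \<equiv> \<lambda>s. \<Sum>j<n. cnj (w s) ^ j *\<^sub>C h j"
  shows "(\<Sum>s<M. Re (cinner (poly_op (fejer_poly N (w s)) T (g s)) (g s)))
    = real M * (real N * toeplitz_form T h n
        - 2 * (\<Sum>j<n. \<Sum>i<j. real (j - i) * Re (cinner ((T ^^ (j - i)) (h j)) (h i))))"
proof -
  have Tk: "bounded_clinear (T ^^ k)" for k by (rule bounded_clinear_funpow[OF T])
  then have Tk_sum: "(T ^^ k) (sum f S) = (\<Sum>i\<in>S. (T ^^ k) (f i))" for k S and f :: "nat \<Rightarrow> 'a"
    by (intro linear_sum bounded_linear.linear) (simp add: bounded_clinear_def)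
  have Tk_scale: "(T ^^ k) (c *\<^sub>C x) = c *\<^sub>C (T ^^ k) x" for k c x
    using Tk by (simp add: bounded_clinear_def)
  define b where "b k i j = cinner ((T ^^ k) (h j)) (h i)" for k i j
  \<comment> \<open>The factors are \<open>w^k\<close> from the polynomial, \<open>cnj w^j\<close>
    from the left vector and, by conjugate linearity, \<open>w^i\<close> from the right one.\<close>
  have form: "cinner (poly_op (fejer_poly N (w s)) T (g s)) (g s)
      = (\<Sum>k<N. \<Sum>j<n. \<Sum>i<n. of_real (fejer_coeff N k) * b k i j * (w s ^ (k + i) * cnj (w s) ^ j))"
    for s
  proof -
    have "poly_op (fejer_poly N (w s)) T (g s)
        = (\<Sum>k<N. (of_real (fejer_coeff N k) * w s ^ k) *\<^sub>C (T ^^ k) (g s))"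
      by (subst poly_op_eq_sum[where N = N]) (auto simp: coeff_fejer_poly)
    then have "cinner (poly_op (fejer_poly N (w s)) T (g s)) (g s)
        = (\<Sum>k<N. of_real (fejer_coeff N k) * w s ^ k * cinner ((T ^^ k) (g s)) (g s))"
      by (simp add: cinner_sum_left cinner_scaleC_left)
    moreover have "cinner ((T ^^ k) (g s)) (g s)
        = (\<Sum>j<n. \<Sum>i<n. cnj (w s) ^ j * (w s ^ i * b k i j))" for k
      unfolding g_def Tk_sum Tk_scale cinner_sum_left cinner_sum_right
      by (subst sum.swap) (simp add: b_def cinner_scaleC_left cinner_scaleC_right mult_ac)
    ultimately show ?thesis
      by (simp add: sum_distrib_left power_add mult_ac)
  qed
  have "(\<Sum>s<M. cinner (poly_op (fejer_poly N (w s)) T (g s)) (g s))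
      = (\<Sum>k<N. \<Sum>s<M. \<Sum>j<n. \<Sum>i<n.
          of_real (fejer_coeff N k) * b k i j * (w s ^ (k + i) * cnj (w s) ^ j))"
    unfolding form by (rule sum.swap)
  also have "\<dots> = (\<Sum>k<N. \<Sum>j<n. \<Sum>i<n. \<Sum>s<M.
          of_real (fejer_coeff N k) * b k i j * (w s ^ (k + i) * cnj (w s) ^ j))"
  proof (rule sum.cong[OF refl])
    fix k
    let ?f = "\<lambda>s j i. of_real (fejer_coeff N k) * b k i j * (w s ^ (k + i) * cnj (w s) ^ j)"
    have "(\<Sum>s<M. \<Sum>j<n. \<Sum>i<n. ?f s j i) = (\<Sum>j<n. \<Sum>s<M. \<Sum>i<n. ?f s j i)"
      by (rule sum.swap)
    also have "\<dots> = (\<Sum>j<n. \<Sum>i<n. \<Sum>s<M. ?f s j i)"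
      by (rule sum.cong[OF refl]) (rule sum.swap)
    finally show "(\<Sum>s<M. \<Sum>j<n. \<Sum>i<n. ?f s j i) = (\<Sum>j<n. \<Sum>i<n. \<Sum>s<M. ?f s j i)" .
  qed
  also have "\<dots> = (\<Sum>k<N. \<Sum>j<n. \<Sum>i<n.
      of_real (fejer_coeff N k) * b k i j * (if k + i = j then of_nat M else 0))"
  proof (intro sum.cong refl)
    fix k j i assume "k \<in> {..<N}" "j \<in> {..<n}" "i \<in> {..<n}"
    \<comment> \<open>\<open>M = N + n\<close> exceeds both exponents, so distinct exponents are
      never congruent modulo \<open>M\<close>.\<close>
    then have "k + i < M" "j < M" by (auto simp: M_def)
    then have "(\<Sum>s<M. w s ^ (k + i) * cnj (w s) ^ j) = (if k + i = j then of_nat M else 0)"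
      unfolding w_def by (rule sum_roots_of_unity)
    then show "(\<Sum>s<M. of_real (fejer_coeff N k) * b k i j * (w s ^ (k + i) * cnj (w s) ^ j))
        = of_real (fejer_coeff N k) * b k i j * (if k + i = j then of_nat M else 0)"
      by (simp flip: sum_distrib_left)
  qed
  also have "\<dots> = (\<Sum>j<n. \<Sum>i<n. \<Sum>k<N.
      of_real (fejer_coeff N k) * b k i j * (if k + i = j then of_nat M else 0))"
    by (subst sum.swap, rule sum.cong[OF refl], rule sum.swap)
  also have "\<dots> = (\<Sum>j<n. \<Sum>i<n.
      if i \<le> j then of_nat M * of_real (fejer_coeff N (j - i)) * b (j - i) i j else 0)"
  proof (intro sum.cong refl)
    fix j i assume "j \<in> {..<n}"
    then have "j < N" using \<open>n \<le> N\<close> by simp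
    then have "j - i < N" by simp
    \<comment> \<open>Only \<open>k = j - i\<close> survives, and only for \<open>i \<le> j\<close>;
      the conditional guards against truncated subtraction.\<close>
    have "(\<Sum>k<N. of_real (fejer_coeff N k) * b k i j * (if k + i = j then of_nat M else 0))
        = (\<Sum>k<N. if k = j - i then (if i \<le> j then
            of_nat M * of_real (fejer_coeff N (j - i)) * b (j - i) i j else 0) else 0)"
      by (intro sum.cong refl) (auto simp: mult_ac)
    also have "\<dots> = (if i \<le> j then
            of_nat M * of_real (fejer_coeff N (j - i)) * b (j - i) i j else 0)"
      using \<open>j - i < N\<close> by simp
    finally show "(\<Sum>k<N. of_real (fejer_coeff N k) * b k i j * (if k + i = j then of_nat M else 0))
        = (if i \<le> j then of_nat M * of_real (fejer_coeff N (j - i)) * b (j - i) i j else 0)" .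
  qed
  also have "\<dots> = (\<Sum>j<n. \<Sum>i<Suc j. of_nat M * of_real (fejer_coeff N (j - i)) * b (j - i) i j)"
  proof (rule sum.cong[OF refl])
    fix j assume "j \<in> {..<n}"
    then have "{i \<in> {..<n}. i \<le> j} = {..<Suc j}" by auto
    then show "(\<Sum>i<n. if i \<le> j then of_nat M * of_real (fejer_coeff N (j - i)) * b (j - i) i j else 0)
        = (\<Sum>i<Suc j. of_nat M * of_real (fejer_coeff N (j - i)) * b (j - i) i j)"
      by (simp flip: sum.inter_filter del: sum.lessThan_Suc)
  qed
  finally have "(\<Sum>s<M. Re (cinner (poly_op (fejer_poly N (w s)) T (g s)) (g s)))
      = Re (\<Sum>j<n. \<Sum>i<Suc j. of_nat M * of_real (fejer_coeff N (j - i)) * b (j - i) i j)"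
    unfolding Re_sum[symmetric] by (rule arg_cong)
  also have "\<dots> = real M * (\<Sum>j<n. real N * (norm (h j))\<^sup>2
      + (\<Sum>i<j. 2 * (real N - real (j - i)) * Re (b (j - i) i j)))"
  proof -
    have "Re (\<Sum>i<Suc j. of_nat M * of_real (fejer_coeff N (j - i)) * b (j - i) i j)
      = real M * (real N * (norm (h j))\<^sup>2
      + (\<Sum>i<j. 2 * (real N - real (j - i)) * Re (b (j - i) i j)))" for j
      by (simp add: b_def cinner_self fejer_coeff_def sum_distrib_left algebra_simps)
    then show ?thesis by (simp only: Re_sum sum_distrib_left)
  qed
  also have "\<dots> = real M * (real N * toeplitz_form T h n
        - 2 * (\<Sum>j<n. \<Sum>i<j. real (j - i) * Re (b (j - i) i j)))"
    by (simp add: toeplitz_form_def b_def sum.distrib sum_subtractf sum_distrib_left algebra_simps)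
  finally show ?thesis unfolding b_def .
qed

text \<open>Domination is applied to the rotated Fejer polynomials and summed over the roots of
  unity. After division by \<open>N + n\<close>, each side is linear in \<open>N\<close> with a
  Toeplitz form as leading coefficient, so large \<open>N\<close> leaves the forms, with the same
  \<open>c\<close>.\<close>

lemma harnack_dominated_toeplitz_form:
  fixes T T' :: "'a::complex_hilbert_space \<Rightarrow> 'a"
  assumes T: "bounded_clinear T" and T': "bounded_clinear T'" and "harnack_dominated T T'"
  shows "\<exists>c\<ge>1. \<forall>h n. toeplitz_form T h n \<le> c * toeplitz_form T' h n"
proof -
  obtain c where "c \<ge> 1" and c: "\<And>p. (\<forall>z. cmod z \<le> 1 \<longrightarrow> 0 \<le> Re (poly p z)) \<Longrightarrow>
      re_op (poly_op p T) \<le>\<^sub>o\<^sub>p (\<lambda>x. c *\<^sub>R re_op (poly_op p T') x)"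
    using assms(3) by (auto simp: harnack_dominated_def)
  have le: "Re (cinner (poly_op p T x) x) \<le> c * Re (cinner (poly_op p T' x) x)"
    if "\<And>z. cmod z \<le> 1 \<Longrightarrow> 0 \<le> Re (poly p z)" for p x
  proof -
    have "0 \<le> Re (cinner (c *\<^sub>R re_op (poly_op p T') x - re_op (poly_op p T) x) x)"
      using c[of p] that by (simp add: op_le_def positive_op_def)
    then show ?thesis
      by (simp add: cinner_diff_left cinner_scaleR_left Re_cinner_re_op bounded_clinear_poly_op T T')
  qed
  have "toeplitz_form T h n - c * toeplitz_form T' h n \<le> 0" for h n
  proof -
    define L where "L S = 2 * (\<Sum>j<n. \<Sum>i<j. real (j - i) * Re (cinner ((S ^^ (j - i)) (h j)) (h i)))"
      for S :: "'a \<Rightarrow> 'a"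
    \<comment> \<open>\<open>Suc n\<close> rather than \<open>n\<close> keeps \<open>N + n\<close>
      positive when \<open>n = 0\<close>, so that it can be cancelled.\<close>
    show ?thesis
    proof (rule affine_le_const_imp_nonpos[where n = "Suc n"])
      fix N :: nat assume "Suc n \<le> N"
      then have "n \<le> N" by simp
      define w where "w s = cis (2 * pi * real s / real (N + n))" for s :: nat
      define g where "g s = (\<Sum>j<n. cnj (w s) ^ j *\<^sub>C h j)" for s
      have "(\<Sum>s<N + n. Re (cinner (poly_op (fejer_poly N (w s)) T (g s)) (g s)))
        \<le> c * (\<Sum>s<N + n. Re (cinner (poly_op (fejer_poly N (w s)) T' (g s)) (g s)))"
        unfolding sum_distrib_left
        by (intro sum_mono le Re_poly_fejer_poly_nonneg) (simp_all add: w_def)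
      then have "real (N + n) * (real N * toeplitz_form T h n - L T)
        \<le> c * (real (N + n) * (real N * toeplitz_form T' h n - L T'))"
        unfolding g_def w_def L_def average_fejer_form[OF T \<open>n \<le> N\<close>] average_fejer_form[OF T' \<open>n \<le> N\<close>] .
      also have "\<dots> = real (N + n) * (c * (real N * toeplitz_form T' h n - L T'))"
        by simp
      finally have "real N * toeplitz_form T h n - L T \<le> c * (real N * toeplitz_form T' h n - L T')"
        using \<open>Suc n \<le> N\<close> by (subst (asm) mult_le_cancel_left_pos) auto
      then show "real N * (toeplitz_form T h n - c * toeplitz_form T' h n) \<le> L T - c * L T'"
        by (simp add: algebra_simps)
    qed
  qed
  then show ?thesis
    using \<open>c \<ge> 1\<close> by auto
qed


section \<open>Contractions\<close>

lemma contraction_bounded_clinear: "contraction T \<Longrightarrow> bounded_clinear T"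
  by (simp add: contraction_def)

lemma contraction_norm_le:
  assumes "contraction T"
  shows "norm (T x) \<le> norm x"
proof -
  have "norm (T x) \<le> onorm T * norm x"
    using assms by (intro onorm) (simp add: contraction_def bounded_clinear_def)
  also have "\<dots> \<le> 1 * norm x"
    using assms by (intro mult_right_mono) (simp_all add: contraction_def)
  finally show ?thesis by simp
qed

lemma contraction_funpow_norm_le:
  fixes T :: "'a::complex_hilbert_space \<Rightarrow> 'a"
  assumes "contraction T"
  shows "norm ((T ^^ n) x) \<le> norm x"
  by (induction n) (auto intro: order_trans[OF contraction_norm_le[OF assms]])

lemma cinner_cadjoint_funpow:
  fixes T :: "'a::complex_hilbert_space \<Rightarrow> 'a"
  assumes "bounded_clinear T"
  shows "cinner ((T ^^ n) x) y = cinner x ((cadjoint T ^^ n) y)"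
  by (induction n arbitrary: x y) (simp_all add: cinner_cadjoint[OF assms] funpow_swap1)

text \<open>Stated for an abstract adjoint pair, so that it also covers \<open>T ^^ n\<close> and
  \<open>cadjoint T ^^ n\<close>.\<close>

lemma norm_adjoint_le:
  assumes adj: "\<And>x y. cinner (A x) y = cinner x (B y)" and "\<And>x. norm (A x) \<le> norm x"
  shows "norm (B y) \<le> norm y"
proof (cases "B y = 0")
  case False
  have "(norm (B y))\<^sup>2 = Re (cinner (A (B y)) y)"
    by (simp add: adj cinner_self)
  also have "\<dots> \<le> norm (A (B y)) * norm y" by (rule Re_cinner_le)
  also have "\<dots> \<le> norm (B y) * norm y"
    by (intro mult_right_mono assms(2)) simp
  finally show ?thesis
    using False by (simp add: power2_eq_square)
qed simp

lemma bounded_clinear_adjoint: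
  fixes A :: "'a::complex_hilbert_space \<Rightarrow> 'b::complex_hilbert_space"
  assumes adj: "\<And>x y. cinner (A x) y = cinner x (B y)" and "\<And>x. norm (A x) \<le> norm x"
  shows "bounded_clinear B"
proof -
  have "B (y + z) = B y + B z" for y z
    by (rule cinner_eqI) (simp add: cinner_add_right flip: adj)
  moreover have scale: "B (c *\<^sub>C y) = c *\<^sub>C B y" for c y
    by (rule cinner_eqI) (simp add: cinner_scaleC_right flip: adj)
  moreover have "norm (B y) \<le> norm y * 1" for y
    using norm_adjoint_le[OF assms] by simp
  ultimately have "bounded_linear B"
    by (intro bounded_linear_intro[where K = 1]) (simp_all add: scaleR_scaleC)
  then show ?thesis by (simp add: bounded_clinear_def scale)
qed

text \<open>Expanding the square, \<open>norm (B (A x) - x)\<close> squared is at most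
  \<open>norm x\<close> squared minus \<open>norm (A x)\<close> squared, which is 0.\<close>

lemma adjoint_fixes_isometric:
  assumes adj: "\<And>x y. cinner (A x) y = cinner x (B y)" and "\<And>x. norm (A x) \<le> norm x"
    and "norm (A x) = norm x"
  shows "B (A x) = x"
proof -
  have "Re (cinner (B (A x)) x) = (norm (A x))\<^sup>2"
    by (subst Re_cinner_commute) (simp add: cinner_self flip: adj)
  moreover have "(norm (B (A x)))\<^sup>2 \<le> (norm (A x))\<^sup>2"
    by (intro power_mono norm_adjoint_le[OF assms(1,2)]) simp
  ultimately have "(norm (B (A x) - x))\<^sup>2 \<le> 0"
    using assms(3) by (simp add: norm_diff_sq)
  then show ?thesis by simp
qed

lemma isometric_if_adjoint_fixes:
  assumes adj: "\<And>x y. cinner (A x) y = cinner x (B y)" and "B (A x) = x"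
  shows "norm (A x) = norm x"
proof -
  have "complex_of_real ((norm (A x))\<^sup>2) = complex_of_real ((norm x)\<^sup>2)"
    using adj[of x "A x"] assms(2) by (simp only: cinner_self)
  then show ?thesis
    by (simp only: of_real_eq_iff power2_eq_iff_nonneg norm_ge_zero)
qed

lemma cadjoint_funpow_fixes_isometric:
  fixes T :: "'a::complex_hilbert_space \<Rightarrow> 'a"
  assumes "contraction T" and "norm ((T ^^ n) x) = norm x"
  shows "(cadjoint T ^^ n) ((T ^^ n) x) = x"
  using assms
  by (intro adjoint_fixes_isometric[where A = "T ^^ n"] cinner_cadjoint_funpow
      contraction_bounded_clinear contraction_funpow_norm_le)

lemma cadjoint_fixes_isometric:
  fixes T :: "'a::complex_hilbert_space \<Rightarrow> 'a"
  assumes "contraction T" and "norm (T x) = norm x"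
  shows "cadjoint T (T x) = x"
  using cadjoint_funpow_fixes_isometric[of T 1 x] assms by simp

lemma contraction_bounded_clinear_cadjoint:
  fixes T :: "'a::complex_hilbert_space \<Rightarrow> 'a"
  assumes "contraction T"
  shows "bounded_clinear (cadjoint T)"
  by (rule bounded_clinear_adjoint[OF cinner_cadjoint[OF contraction_bounded_clinear[OF assms]]
        contraction_norm_le[OF assms]])

section \<open>The reducing isometric part and the asymptotic limit\<close>

lemma funpow_mem_invariant: "T ` M \<subseteq> M \<Longrightarrow> x \<in> M \<Longrightarrow> (T ^^ n) x \<in> M"
  by (induction n) auto

lemma funpow_norm_invariant:
  assumes "T ` M \<subseteq> M" "\<And>x. x \<in> M \<Longrightarrow> norm (T x) = norm x" "x \<in> M"
  shows "norm ((T ^^ n) x) = norm x"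
  by (induction n) (use assms funpow_mem_invariant[OF assms(1,3)] in auto)

lemma closed_csubspace_common_kernel:
  assumes "\<And>i. bounded_clinear (F i)"
  shows "closed_csubspace {x. \<forall>i. F i x = 0}"
proof -
  have F: "bounded_linear (F i)" "F i (c *\<^sub>C x) = c *\<^sub>C F i x" for i c x
    using assms by (auto simp: bounded_clinear_def)
  have "closed {x. F i x = 0}" for i
    by (intro closed_Collect_eq continuous_intros linear_continuous_on F)
  then have "closed {x. \<forall>i. F i x = 0}"
    by (rule closed_Collect_all)
  moreover have "subspace {x. \<forall>i. F i x = 0}"
    using F(1) by (auto simp: subspace_def linear_simps)
  ultimately show ?thesis
    using F(2) by (auto simp: closed_csubspace_def scaleC_zero_right)
qed

lemma bounded_clinear_compose:
  assumes "bounded_clinear A" "bounded_clinear B"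
  shows "bounded_clinear (\<lambda>x. A (B x))"
  using assms bounded_linear_compose[of A B] by (auto simp: bounded_clinear_def)

lemma bounded_clinear_diff:
  assumes "bounded_clinear A" "bounded_clinear B"
  shows "bounded_clinear (\<lambda>x. A x - B x)"
proof -
  have "c *\<^sub>C (x - y) = c *\<^sub>C x - c *\<^sub>C y" for c and x y :: 'b
    using scaleC_add_right[of c "x - y" y] by simp
  then show ?thesis
    using assms by (auto simp: bounded_clinear_def bounded_linear_sub)
qed

text \<open>\<open>GREATEST\<close> says something only once a greatest element is exhibited. The
  candidate \<open>G\<close> collects the \<open>x\<close> such that every power of \<open>T\<close>
  preserves the norm of every \<open>T*^m x\<close>.\<close>

lemma reducing_isometric_part_greatest:
  fixes T :: "'a::complex_hilbert_space \<Rightarrow> 'a"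
  assumes T: "contraction T"
  shows "reduces (reducing_isometric_part T) T"
    and "x \<in> reducing_isometric_part T \<Longrightarrow> norm (T x) = norm x"
    and "reduces M T \<Longrightarrow> (\<And>x. x \<in> M \<Longrightarrow> norm (T x) = norm x) \<Longrightarrow>
      M \<subseteq> reducing_isometric_part T"
proof -
  let ?S = "cadjoint T"
  \<comment> \<open>Norm conditions are written as operator equations, so that \<open>G\<close> is a
    common kernel and hence a closed subspace; \<open>p\<close> is the pair of exponents.\<close>
  define G where "G = {x. \<forall>p. (?S ^^ fst p) ((T ^^ fst p) ((?S ^^ snd p) x)) - (?S ^^ snd p) x = 0}"
  have G_iff: "x \<in> G \<longleftrightarrow> (\<forall>n m. (?S ^^ n) ((T ^^ n) ((?S ^^ m) x)) = (?S ^^ m) x)" for x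
    by (auto simp: G_def)
  have "closed_csubspace G"
    unfolding G_def
  proof (rule closed_csubspace_common_kernel)
    fix p :: "nat \<times> nat"
    have S: "bounded_clinear (?S ^^ k)" and T: "bounded_clinear (T ^^ k)" for k
      using T contraction_bounded_clinear contraction_bounded_clinear_cadjoint
      by (auto intro: bounded_clinear_funpow)
    show "bounded_clinear (\<lambda>x. (?S ^^ fst p) ((T ^^ fst p) ((?S ^^ snd p) x)) - (?S ^^ snd p) x)"
      by (rule bounded_clinear_diff[OF
          bounded_clinear_compose[OF S bounded_clinear_compose[OF T S]] S])
  qed
  moreover have "?S x \<in> G" if "x \<in> G" for x
    using that unfolding G_iff by (metis funpow.simps(2) funpow_swap1 comp_apply)
  moreover have iso: "norm (T x) = norm x" if "x \<in> G" for x
  proof -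
    have "?S (T x) = x"
      using that[unfolded G_iff, rule_format, of 1 0] by simp
    then show ?thesis
      by (rule isometric_if_adjoint_fixes[OF cinner_cadjoint[OF contraction_bounded_clinear[OF T]]])
  qed
  moreover have "T x \<in> G" if "x \<in> G" for x
    unfolding G_iff
  proof (intro allI)
    fix n m
    have x: "?S (T x) = x"
      using that[unfolded G_iff, rule_format, of 1 0] by simp
    show "(?S ^^ n) ((T ^^ n) ((?S ^^ m) (T x))) = (?S ^^ m) (T x)"
    proof (cases m)
      case 0
      \<comment> \<open>Both \<open>T^(n+1)\<close> and \<open>T\<close> preserve the norm of
        \<open>x\<close>, so \<open>T^n\<close> preserves that of \<open>T x\<close>.\<close>
      have "norm ((T ^^ k) x) = norm x" for k
      proof -
        have "(?S ^^ k) ((T ^^ k) x) = x"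
          using that[unfolded G_iff, rule_format, of k 0] by simp
        then show ?thesis
          by (rule isometric_if_adjoint_fixes[OF
                cinner_cadjoint_funpow[OF contraction_bounded_clinear[OF T]]])
      qed
      from this[of "Suc n"] this[of 1] have "norm ((T ^^ n) (T x)) = norm (T x)"
        by (simp add: funpow_swap1)
      then show ?thesis
        using 0 by (simp add: cadjoint_funpow_fixes_isometric[OF T])
    next
      case (Suc k)
      then show ?thesis
        using that by (simp add: funpow_swap1 x G_iff)
    qed
  qed
  ultimately have G: "reduces G T \<and> (\<forall>x\<in>G. norm (T x) = norm x)"
    by (auto simp: reduces_def)
  have max: "M \<subseteq> G" if M: "reduces M T" "\<forall>x\<in>M. norm (T x) = norm x" for M
  proof
    fix x assume "x \<in> M"
    have "(?S ^^ n) ((T ^^ n) ((?S ^^ m) x)) = (?S ^^ m) x" for n m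
      using M \<open>x \<in> M\<close>
      by (intro cadjoint_funpow_fixes_isometric[OF T] funpow_norm_invariant[of T M]
          funpow_mem_invariant[of ?S M]) (auto simp: reduces_def)
    then show "x \<in> G" by (simp add: G_iff)
  qed
  have eq: "reducing_isometric_part T = G"
    unfolding reducing_isometric_part_def
    by (rule Greatest_equality) (use G max in blast)+
  show "reduces (reducing_isometric_part T) T"
    and "x \<in> reducing_isometric_part T \<Longrightarrow> norm (T x) = norm x"
    and "reduces M T \<Longrightarrow> (\<And>x. x \<in> M \<Longrightarrow> norm (T x) = norm x) \<Longrightarrow>
      M \<subseteq> reducing_isometric_part T"
    using G max unfolding eq by blast+
qed

section \<open>The asymptotic limit\<close>

text \<open>
  For \<open>0 \<le> D \<le> I\<close> one has \<open>\<parallel>D x\<parallel>\<^sup>2 \<le> \<langle>D x, x\<rangle>\<close>; with \<open>D = T\<^sup>*\<^sup>n T\<^sup>n - T\<^sup>*\<^sup>m T\<^sup>m\<close> this turns convergence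
  of \<open>\<parallel>T\<^sup>n x\<parallel>\<^sup>2\<close> into strong convergence of \<open>T\<^sup>*\<^sup>n T\<^sup>n\<close>.
\<close>

lemma convergent_cadjoint_funpow:
  fixes T :: "'a::complex_hilbert_space \<Rightarrow> 'a"
  assumes T: "contraction T"
  shows "convergent (\<lambda>n. (cadjoint T ^^ n) ((T ^^ n) x))"
proof -
  let ?A = "\<lambda>n x. (cadjoint T ^^ n) ((T ^^ n) x)"
  have bcl: "bounded_clinear T" by (rule contraction_bounded_clinear[OF T])
  have A: "Re (cinner (?A n x) y) = Re (cinner ((T ^^ n) x) ((T ^^ n) y))" for n x y
    by (metis Re_cinner_commute cinner_cadjoint_funpow[OF bcl])
  have diff: "(T ^^ n) (x - y) = (T ^^ n) x - (T ^^ n) y" for n x y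
    using bounded_clinear_funpow[OF bcl, of n] by (simp add: bounded_clinear_def linear_simps)
  have dec: "(norm ((T ^^ m) x))\<^sup>2 \<le> (norm ((T ^^ n) x))\<^sup>2" if "n \<le> m" for m n x
  proof (rule power_mono)
    have "(T ^^ m) x = (T ^^ (m - n)) ((T ^^ n) x)"
      using that by (simp flip: funpow_add comp_apply[of "T ^^ (m - n)"])
    then show "norm ((T ^^ m) x) \<le> norm ((T ^^ n) x)"
      by (simp add: contraction_funpow_norm_le[OF T])
  qed simp
  have key: "(norm (?A n x - ?A m x))\<^sup>2 \<le> (norm ((T ^^ n) x))\<^sup>2 - (norm ((T ^^ m) x))\<^sup>2"
    if "n \<le> m" for m n
  proof -
    define y where "y = ?A n x - ?A m x"
    have y: "(norm y)\<^sup>2 = Re (cinner ((T ^^ n) x) ((T ^^ n) y)) - Re (cinner ((T ^^ m) x) ((T ^^ m) y))"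
    proof -
      have "(norm y)\<^sup>2 = Re (cinner (?A n x - ?A m x) y)"
        unfolding y_def[symmetric] by (simp add: cinner_self)
      then show ?thesis by (simp add: cinner_diff_left A)
    qed
    \<comment> \<open>With \<open>y = D x\<close>, nonnegativity of
      \<open><D (x - y), x - y> = <D x, x> - 2 <y, y> + <D y, y>\<close> and
      \<open><D y, y> \<le> <y, y>\<close> give \<open><y, y> \<le> <D x, x>\<close>.\<close>
    have "(norm ((T ^^ m) (x - y)))\<^sup>2 \<le> (norm ((T ^^ n) (x - y)))\<^sup>2"
      by (rule dec[OF that])
    moreover have "(norm ((T ^^ n) y))\<^sup>2 \<le> (norm y)\<^sup>2"
      by (intro power_mono contraction_funpow_norm_le[OF T]) simp
    moreover have "0 \<le> (norm ((T ^^ m) y))\<^sup>2" by simp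
    ultimately have "(norm y)\<^sup>2 \<le> (norm ((T ^^ n) x))\<^sup>2 - (norm ((T ^^ m) x))\<^sup>2"
      using y unfolding diff norm_diff_sq by linarith
    then show ?thesis by (simp add: y_def)
  qed
  have "decseq (\<lambda>n. (norm ((T ^^ n) x))\<^sup>2)"
    using dec by (auto simp: decseq_def)
  then have "convergent (\<lambda>n. (norm ((T ^^ n) x))\<^sup>2)"
    by (rule decseq_convergent[where B = 0]) (auto simp: convergent_def)
  then have Cau: "Cauchy (\<lambda>n. (norm ((T ^^ n) x))\<^sup>2)"
    by (rule convergent_Cauchy)
  have "Cauchy (\<lambda>n. ?A n x)"
  proof (rule metric_CauchyI)
    fix e :: real assume "0 < e"
    then obtain M where M: "\<And>m n. m \<ge> M \<Longrightarrow> n \<ge> M \<Longrightarrow>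
        dist ((norm ((T ^^ m) x))\<^sup>2) ((norm ((T ^^ n) x))\<^sup>2) < e\<^sup>2"
      using metric_CauchyD[OF Cau, of "e\<^sup>2"] by auto
    have le: "dist (?A n x) (?A m x) < e" if "n \<ge> M" "n \<le> m" for m n
    proof -
      have "(norm (?A n x - ?A m x))\<^sup>2 < e\<^sup>2"
        using key[OF \<open>n \<le> m\<close>] M[of n m] that by (simp add: dist_real_def)
      then show ?thesis
        using \<open>0 < e\<close> by (simp add: dist_norm power2_less_imp_less)
    qed
    have "dist (?A m x) (?A n x) < e" if "m \<ge> M" "n \<ge> M" for m n
      using le[of m n] le[of n m] that by (metis dist_commute linear)
    then show "\<exists>M. \<forall>m\<ge>M. \<forall>n\<ge>M. dist (?A m x) (?A n x) < e" by blast
  qed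
  then show ?thesis by (simp add: Cauchy_convergent_iff)
qed

text \<open>If the limit fixes \<open>x\<close>, the squared norms \<open><T*^n T^n x, x>\<close>
  decrease from that of \<open>x\<close> and also tend to it, so they are constant. Conversely,
  constant norms give \<open>T*^n T^n x = x\<close> for all \<open>n\<close>.\<close>

lemma null_space_asymptotic_limit:
  fixes T :: "'a::complex_hilbert_space \<Rightarrow> 'a"
  assumes T: "contraction T"
  shows "null_space (\<lambda>h. h - asymptotic_limit T h) = {x. \<forall>n. norm ((T ^^ n) x) = norm x}"
proof (intro set_eqI iffI CollectI allI)
  let ?A = "\<lambda>n x. (cadjoint T ^^ n) ((T ^^ n) x)"
  fix x n assume "x \<in> null_space (\<lambda>h. h - asymptotic_limit T h)"
  then have "(\<lambda>n. ?A n x) \<longlonglongrightarrow> x"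
    using convergent_cadjoint_funpow[OF T, of x]
    by (simp add: null_space_def asymptotic_limit_def convergent_LIMSEQ_iff)
  then have "(\<lambda>n. Re (cinner (?A n x) x)) \<longlonglongrightarrow> Re (cinner x x)"
    by (rule bounded_linear.tendsto[OF bounded_linear_Re_cinner])
  moreover have "Re (cinner (?A n x) x) = (norm ((T ^^ n) x))\<^sup>2" for n
    by (subst Re_cinner_commute)
      (simp add: cinner_self flip: cinner_cadjoint_funpow[OF contraction_bounded_clinear[OF T]])
  ultimately have lim: "(\<lambda>n. (norm ((T ^^ n) x))\<^sup>2) \<longlonglongrightarrow> (norm x)\<^sup>2"
    by (simp add: cinner_self)
  have "(norm x)\<^sup>2 \<le> (norm ((T ^^ n) x))\<^sup>2"
  proof (rule LIMSEQ_le_const2[OF lim], intro exI allI impI)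
    fix m assume "n \<le> m"
    then have "(T ^^ m) x = (T ^^ (m - n)) ((T ^^ n) x)"
      by (simp flip: funpow_add comp_apply[of "T ^^ (m - n)"])
    then show "(norm ((T ^^ m) x))\<^sup>2 \<le> (norm ((T ^^ n) x))\<^sup>2"
      by (intro power_mono) (simp_all add: contraction_funpow_norm_le[OF T])
  qed
  then show "norm ((T ^^ n) x) = norm x"
    using contraction_funpow_norm_le[OF T, of n x] by (simp add: abs_le_square_iff)
next
  fix x assume "x \<in> {x. \<forall>n. norm ((T ^^ n) x) = norm x}"
  then have "(cadjoint T ^^ n) ((T ^^ n) x) = x" for n
    by (intro cadjoint_funpow_fixes_isometric[OF T]) simp
  then show "x \<in> null_space (\<lambda>h. h - asymptotic_limit T h)"
    by (simp add: null_space_def asymptotic_limit_def)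
qed

lemma reducing_isometric_part_subset_null_space:
  fixes T :: "'a::complex_hilbert_space \<Rightarrow> 'a"
  assumes T: "contraction T"
  shows "reducing_isometric_part T \<subseteq> null_space (\<lambda>h. h - asymptotic_limit T h)"
proof -
  have "T ` reducing_isometric_part T \<subseteq> reducing_isometric_part T"
    using reducing_isometric_part_greatest(1)[OF T] by (simp add: reduces_def)
  from funpow_norm_invariant[OF this reducing_isometric_part_greatest(2)[OF T]]
  show ?thesis
    unfolding null_space_asymptotic_limit[OF T] by blast
qed

section \<open>Harnack domination of commuting contractions\<close>

text \<open>For an isometric dilation \<open>V'\<close> of \<open>T'\<close>, equal norms mean
  \<open>V' x = T' x\<close>. The form of \<open>T\<close> at the same two vectors is then at most
  0, which is the equality case of Cauchy-Schwarz for \<open>T x\<close> and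
  \<open>T' x\<close>.\<close>

lemma harnack_dominated_eq_if_isometric:
  fixes T T' :: "'a::complex_hilbert_space \<Rightarrow> 'a"
  assumes T: "contraction T" and T': "contraction T'" and "harnack_dominated T T'"
    and iso: "norm (T' x) = norm x"
  shows "T x = T' x"
proof -
  obtain c where "c \<ge> 1" and c: "\<And>h n. toeplitz_form T h n \<le> c * toeplitz_form T' h n"
    using harnack_dominated_toeplitz_form[OF contraction_bounded_clinear[OF T]
        contraction_bounded_clinear[OF T'] \<open>harnack_dominated T T'\<close>] by auto
  \<comment> \<open>These vectors encode \<open>V' x - T' x\<close>.\<close>
  define h where "h j = (if j = 0 then - T' x else x)" for j :: nat
  have form: "toeplitz_form S h 2 = 2 * (norm x)\<^sup>2 - 2 * Re (cinner (S x) (T' x))" for S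
    by (simp add: toeplitz_form_def h_def numeral_2_eq_2 cinner_minus_right iso)
  have "toeplitz_form T' h 2 = 0"
    by (simp add: form cinner_self iso)
  then have "2 * (norm x)\<^sup>2 - 2 * Re (cinner (T x) (T' x)) \<le> 0"
    using c[of h 2] by (simp add: form)
  moreover have "(norm (T x))\<^sup>2 \<le> (norm x)\<^sup>2"
    by (intro power_mono contraction_norm_le[OF T]) simp
  ultimately have "(norm (T x - T' x))\<^sup>2 \<le> 0"
    unfolding norm_diff_sq iso by linarith
  then show ?thesis by simp
qed

lemma cadjoint_commute:
  fixes T T' :: "'a::complex_hilbert_space \<Rightarrow> 'a"
  assumes "bounded_clinear T" "bounded_clinear T'" "T \<circ> T' = T' \<circ> T"
  shows "cadjoint T (cadjoint T' y) = cadjoint T' (cadjoint T y)"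
proof (rule cinner_eqI)
  fix x
  have "cinner x (cadjoint T (cadjoint T' y)) = cinner (T' (T x)) y"
    by (simp add: cinner_cadjoint assms(1,2))
  also have "T' (T x) = T (T' x)"
    using fun_cong[OF assms(3), of x] by simp
  also have "cinner (T (T' x)) y = cinner x (cadjoint T' (cadjoint T y))"
    by (simp add: cinner_cadjoint assms(1,2))
  finally show "cinner x (cadjoint T (cadjoint T' y)) = cinner x (cadjoint T' (cadjoint T y))" .
qed

text \<open>Agreement gives invariance under \<open>T\<close>, commuting adjoints give invariance
  under \<open>T*\<close>, and maximality then gives the inclusion.\<close>

lemma reducing_isometric_part_harnack:
  fixes T T' :: "'a::complex_hilbert_space \<Rightarrow> 'a"
  assumes T: "contraction T" and T': "contraction T'" and comm: "T \<circ> T' = T' \<circ> T"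
    and "harnack_dominated T T'"
  shows "h \<in> reducing_isometric_part T' \<Longrightarrow> T h = T' h"
    and "reduces (reducing_isometric_part T') T"
    and "reducing_isometric_part T' \<subseteq> reducing_isometric_part T"
proof -
  let ?M = "reducing_isometric_part T'"
  note M = reducing_isometric_part_greatest(1,2)[OF T']
  show eq: "T h = T' h" if "h \<in> ?M" for h
    using harnack_dominated_eq_if_isometric[OF T T' assms(4)] M(2)[OF that] by blast
  have adj: "cadjoint T h = cadjoint T' h" if "h \<in> ?M" for h
  proof -
    have "cadjoint T' (T' h) = h" "cadjoint T (T h) = h"
      using M(2)[OF that] eq[OF that] cadjoint_fixes_isometric T T' by metis+
    then show ?thesis
      using cadjoint_commute[of T T' "T h"] comm eq[OF that]
        contraction_bounded_clinear[OF T] contraction_bounded_clinear[OF T'] by metis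
  qed
  show red: "reduces ?M T"
    using M(1) eq adj by (auto simp: reduces_def)
  show "?M \<subseteq> reducing_isometric_part T"
    using reducing_isometric_part_greatest(3)[OF T red] M(2) eq by metis
qed

text \<open>
  For \<open>y = T z - T' z\<close> and \<open>h j = T\<^sup>m\<^sup>-\<^sup>j y\<close>, the form of \<open>T\<close> is \<open>(m + 1)\<^sup>2 \<parallel>y\<parallel>\<^sup>2\<close>, whereas
  the inner sums of the form of \<open>T'\<close> telescope, so that it grows only linearly in \<open>m\<close>. This is
  the mean ergodic theorem for \<open>T\<^sup>-\<^sup>1 T'\<close> in disguise.
\<close>

lemma harnack_dominated_eq_on_invariant:
  fixes T T' :: "'a::complex_hilbert_space \<Rightarrow> 'a"
  assumes T: "contraction T" and T': "contraction T'" and comm: "T \<circ> T' = T' \<circ> T"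
    and "harnack_dominated T T'"
    and M: "subspace M" "T ` M \<subseteq> M" "T' ` M \<subseteq> M" and iso: "\<And>x. x \<in> M \<Longrightarrow> norm (T x) = norm x"
    and "z \<in> M"
  shows "T z = T' z"
proof -
  obtain c where "c \<ge> 1" and c: "\<And>h n. toeplitz_form T h n \<le> c * toeplitz_form T' h n"
    using harnack_dominated_toeplitz_form[OF contraction_bounded_clinear[OF T]
        contraction_bounded_clinear[OF T'] \<open>harnack_dominated T T'\<close>] by auto
  define y where "y = T z - T' z"
  have "y \<in> M"
    unfolding y_def using M \<open>z \<in> M\<close> by (intro subspace_diff) auto
  have TM: "(T ^^ n) x \<in> M" "(T' ^^ n) x \<in> M" if "x \<in> M" for n x
    by (rule funpow_mem_invariant[OF M(2) that], rule funpow_mem_invariant[OF M(3) that])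
  \<comment> \<open>Only \<open>v\<close> has to lie in \<open>M\<close>, since the identity used is
    \<open>T*^n T^n v = v\<close>.\<close>
  have ip: "cinner ((T ^^ n) x) ((T ^^ n) v) = cinner x v" if "v \<in> M" for n x v
    using funpow_norm_invariant[OF M(2) iso that]
    by (simp add: cinner_cadjoint_funpow[OF contraction_bounded_clinear[OF T]]
        cadjoint_funpow_fixes_isometric[OF T])
  have norm_T: "norm ((T ^^ n) x) = norm x" if "x \<in> M" for n x
    by (rule funpow_norm_invariant[OF M(2) iso that])
  have comm1: "T (T' x) = T' (T x)" for x
    using comm by (metis comp_apply)
  have commT: "T ((T' ^^ k) x) = (T' ^^ k) (T x)" for k x
    by (induction k) (simp_all add: comm1)
  have commTT: "(T' ^^ k) ((T ^^ n) x) = (T ^^ n) ((T' ^^ k) x)" for k n x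
    by (induction n) (simp_all flip: commT)
  have lin: "(S ^^ k) (u - v) = (S ^^ k) u - (S ^^ k) v" if "contraction S"
    for S :: "'a \<Rightarrow> 'a" and k u v
    using bounded_clinear_funpow[OF contraction_bounded_clinear[OF that], of k]
    by (simp add: bounded_clinear_def linear_simps)
  define a where "a k = Re (cinner ((T' ^^ k) y) ((T ^^ k) y))" for k
  \<comment> \<open>In the induction step \<open>T\<close> is applied to both vectors; adding
    \<open>T'^(j+1) y\<close> with \<open>y = T z - T' z\<close> then turns
    \<open>T'^(j+1) (T z)\<close> into \<open>T'^(j+2) z\<close>.\<close>
  have tele: "(\<Sum>k<Suc j. a k) = Re (cinner ((T ^^ Suc j) z - (T' ^^ Suc j) z) ((T ^^ j) y))" for j
  proof (induction j)
    case 0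
    then show ?case by (simp add: a_def y_def)
  next
    case (Suc j)
    have "cinner ((T ^^ Suc j) z - (T' ^^ Suc j) z) ((T ^^ j) y)
        = cinner ((T ^^ 1) ((T ^^ Suc j) z - (T' ^^ Suc j) z)) ((T ^^ 1) ((T ^^ j) y))"
      by (rule ip[symmetric]) (rule TM[OF \<open>y \<in> M\<close>])
    also have "\<dots> = cinner ((T ^^ Suc (Suc j)) z - (T' ^^ Suc j) (T z)) ((T ^^ Suc j) y)"
      unfolding lin[OF T] by (simp add: commT comm1)
    finally have "(\<Sum>k<Suc (Suc j). a k)
        = Re (cinner ((T ^^ Suc (Suc j)) z - (T' ^^ Suc j) (T z) + (T' ^^ Suc j) y) ((T ^^ Suc j) y))"
      unfolding sum.lessThan_Suc[of a "Suc j"] Suc by (simp only: a_def cinner_add_left plus_complex.sel)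
    also have "(T ^^ Suc (Suc j)) z - (T' ^^ Suc j) (T z) + (T' ^^ Suc j) y
        = (T ^^ Suc (Suc j)) z - (T' ^^ Suc (Suc j)) z"
      unfolding y_def lin[OF T'] by (simp add: funpow_swap1)
    finally show ?case .
  qed
  \<comment> \<open>\<open>T^(j+1) z - T'^(j+1) z\<close> has norm at most
    \<open>2 * norm z\<close>, so the bound is uniform in \<open>j\<close>.\<close>
  define C where "C = 2 * norm z * norm y"
  have bound: "(\<Sum>k<Suc j. a k) \<le> C" for j
  proof -
    have "(\<Sum>k<Suc j. a k) \<le> norm ((T ^^ Suc j) z - (T' ^^ Suc j) z) * norm ((T ^^ j) y)"
      unfolding tele by (rule Re_cinner_le)
    also have "\<dots> \<le> (norm z + norm z) * norm y"
      by (intro mult_mono norm_triangle_le_diff add_mono contraction_funpow_norm_le T T') auto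
    finally show ?thesis by (simp add: C_def)
  qed
  have "(norm y)\<^sup>2 \<le> 0"
  proof (rule affine_le_const_imp_nonpos[where n = 1])
    fix N :: nat assume "1 \<le> N"
    then obtain m where N: "N = Suc m" by (cases N) auto
    \<comment> \<open>Powers decrease with the index so that \<open>T^(j-i)\<close> maps
      \<open>h j\<close> to \<open>h i\<close>, which makes all cross terms of the form of
      \<open>T\<close> equal.\<close>
    define h where "h j = (T ^^ (m - j)) y" for j
    have norm_h: "norm (h j) = norm y" for j
      by (simp add: h_def norm_T \<open>y \<in> M\<close>)
    have "cinner ((T ^^ (j - i)) (h j)) (h i) = of_real ((norm y)\<^sup>2)" if "i < j" "j < N" for i j
    proof -
      have "(T ^^ (j - i)) (h j) = h i"
        unfolding h_def using that N by (simp flip: funpow_add comp_apply[of "T ^^ (j - i)"])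
      then show ?thesis by (simp add: cinner_self norm_h)
    qed
    then have "toeplitz_form T h N = real N * (norm y)\<^sup>2 + 2 * (\<Sum>j<N. real j * (norm y)\<^sup>2)"
      by (simp add: toeplitz_form_def norm_h)
    also have "\<dots> = (real N)\<^sup>2 * (norm y)\<^sup>2"
    proof -
      have "2 * (\<Sum>j<N. real j) = real N * (real N - 1)"
        by (induction N) (simp_all add: algebra_simps)
      then have "2 * (\<Sum>j<N. real j * (norm y)\<^sup>2) = real N * (real N - 1) * (norm y)\<^sup>2"
        by (simp flip: sum_distrib_right)
      then show ?thesis by (simp add: power2_eq_square algebra_simps)
    qed
    finally have lhs: "toeplitz_form T h N = (real N)\<^sup>2 * (norm y)\<^sup>2" .
    have "(\<Sum>i<j. Re (cinner ((T' ^^ (j - i)) (h j)) (h i))) \<le> C" if "j < N" for j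
    proof -
      \<comment> \<open>Both vectors carry the common factor \<open>T^(m-j)\<close>, which
        \<open>ip\<close> cancels.\<close>
      have "Re (cinner ((T' ^^ (j - i)) (h j)) (h i)) = a (j - i)" if "i < j" for i
      proof -
        have "h i = (T ^^ (m - j)) ((T ^^ (j - i)) y)"
          unfolding h_def using that \<open>j < N\<close> N by (simp flip: funpow_add comp_apply[of "T ^^ (m - j)"])
        then show ?thesis
          by (simp add: h_def a_def commTT ip TM \<open>y \<in> M\<close>)
      qed
      then have "(\<Sum>i<j. Re (cinner ((T' ^^ (j - i)) (h j)) (h i))) = (\<Sum>i<j. a (j - i))"
        by simp
      also have "\<dots> = (\<Sum>i<j. a (Suc i))"
        using sum.nat_diff_reindex[of "\<lambda>i. a (Suc i)" j] by (simp add: Suc_diff_Suc cong: sum.cong_simp)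
      \<comment> \<open>The telescoping sum includes \<open>a 0\<close>, the squared norm of
        \<open>y\<close>; the cross terms start at \<open>a 1\<close>.\<close>
      also have "\<dots> = (\<Sum>k<Suc j. a k) - (norm y)\<^sup>2"
        unfolding sum.lessThan_Suc_shift by (simp add: a_def cinner_self)
      also have "\<dots> \<le> C" using bound[of j] by (smt (verit) zero_le_power2)
      finally show ?thesis .
    qed
    then have "(\<Sum>j<N. \<Sum>i<j. Re (cinner ((T' ^^ (j - i)) (h j)) (h i))) \<le> (\<Sum>j<N. C)"
      by (intro sum_mono) simp
    then have "toeplitz_form T' h N \<le> real N * ((norm y)\<^sup>2 + 2 * C)"
      by (simp add: toeplitz_form_def norm_h algebra_simps)
    then have "c * toeplitz_form T' h N \<le> c * (real N * ((norm y)\<^sup>2 + 2 * C))"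
      using \<open>c \<ge> 1\<close> by (intro mult_left_mono) auto
    with c[of h N] lhs have "real N * (real N * (norm y)\<^sup>2) \<le> real N * (c * ((norm y)\<^sup>2 + 2 * C))"
      by (simp add: power2_eq_square algebra_simps)
    then show "real N * (norm y)\<^sup>2 \<le> c * ((norm y)\<^sup>2 + 2 * C)"
      using \<open>1 \<le> N\<close> by (subst (asm) mult_le_cancel_left_pos) auto
  qed
  then show ?thesis by (simp add: y_def)
qed

text \<open>\<open>T\<close> is isometric on this \<open>T\<close>-invariant space, which reduces
  \<open>T'\<close>, so both operators agree there; hence \<open>T'\<close> is isometric on it and
  maximality applies.\<close>

lemma null_space_asymptotic_limit_harnack:
  fixes T T' :: "'a::complex_hilbert_space \<Rightarrow> 'a"
  assumes T: "contraction T" and T': "contraction T'" and comm: "T \<circ> T' = T' \<circ> T"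
    and dom: "harnack_dominated T T'"
    and red: "reduces (null_space (\<lambda>h. h - asymptotic_limit T h)) T'"
  shows "null_space (\<lambda>h. h - asymptotic_limit T h) \<subseteq> reducing_isometric_part T'"
proof -
  let ?M = "null_space (\<lambda>h. h - asymptotic_limit T h)"
  have iso: "norm (T x) = norm x" if "x \<in> ?M" for x
    using that[unfolded null_space_asymptotic_limit[OF T]] by (auto dest: spec[of _ 1])
  have "T x \<in> ?M" if "x \<in> ?M" for x
    unfolding null_space_asymptotic_limit[OF T]
  proof (intro CollectI allI)
    fix n
    show "norm ((T ^^ n) (T x)) = norm (T x)"
      using that[unfolded null_space_asymptotic_limit[OF T]] iso[OF that]
      by (auto simp: funpow_swap1 dest: spec[of _ "Suc n"])
  qed
  then have inv: "T ` ?M \<subseteq> ?M" by blast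
  have "subspace ?M" "T' ` ?M \<subseteq> ?M"
    using red by (simp_all add: reduces_def closed_csubspace_def)
  then have "T x = T' x" if "x \<in> ?M" for x
    using harnack_dominated_eq_on_invariant[OF T T' comm dom _ inv _ iso that] by simp
  then show ?thesis
    using reducing_isometric_part_greatest(3)[OF T' red] iso by metis
qed

text \<open>Constant norms along the orbit of \<open>x\<close> under \<open>T'\<close> force
  agreement at each \<open>T'^n x\<close>, so the two orbits coincide.\<close>

lemma null_space_asymptotic_limit_mono:
  fixes T T' :: "'a::complex_hilbert_space \<Rightarrow> 'a"
  assumes T: "contraction T" and T': "contraction T'" and dom: "harnack_dominated T T'"
  shows "null_space (\<lambda>h. h - asymptotic_limit T' h) \<subseteq> null_space (\<lambda>h. h - asymptotic_limit T h)"
  unfolding null_space_asymptotic_limit[OF T] null_space_asymptotic_limit[OF T']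
proof (intro subsetI CollectI allI)
  fix x n assume "x \<in> {x. \<forall>n. norm ((T' ^^ n) x) = norm x}"
  then have x: "norm ((T' ^^ n) x) = norm x" for n by blast
  have "T ((T' ^^ n) x) = T' ((T' ^^ n) x)" for n
    using x[of "Suc n"] x[of n] by (intro harnack_dominated_eq_if_isometric[OF T T' dom]) simp
  then have "(T ^^ n) x = (T' ^^ n) x" by (induction n) simp_all
  then show "norm ((T ^^ n) x) = norm x" by (simp add: x)
qed

theorem theorem2p6:
  fixes T T' :: "'h::complex_hilbert_space \<Rightarrow> 'h"
  assumes "contraction T" and "contraction T'"
    and "T \<circ> T' = T' \<circ> T"
    and "harnack_dominated T T'"
  shows
    "(reducing_isometric_part T' \<subseteq> reducing_isometric_part T \<and>
      (\<forall>h\<in>reducing_isometric_part T'. T' h = T h))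
     \<and>
     (reducing_isometric_part T \<subseteq> null_space (defect_op T') \<longrightarrow>
        reduces (reducing_isometric_part T') T \<and>
        (reduces (null_space (\<lambda>h. h - asymptotic_limit T h)) T' \<longrightarrow>
           reducing_isometric_part T = reducing_isometric_part T' \<and>
           reducing_isometric_part T' = null_space (\<lambda>h. h - asymptotic_limit T' h) \<and>
           null_space (\<lambda>h. h - asymptotic_limit T' h) = null_space (\<lambda>h. h - asymptotic_limit T h)))
     \<and>
     (\<forall>(J :: 'h \<Rightarrow> 'k::complex_hilbert_space) V (J' :: 'h \<Rightarrow> 'l::complex_hilbert_space) V' A.
        minimal_isometric_dilation T J V \<and> minimal_isometric_dilation T' J' V' \<and>
        harnack_operator J V J' V' A \<and> inj A \<longrightarrow>
        reduces (reducing_isometric_part T') T)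
     \<and>
     (harnack_equivalent T T' \<longrightarrow> reducing_isometric_part T = reducing_isometric_part T')"
proof -
  note part = reducing_isometric_part_harnack[OF assms]
  \<comment> \<open>The inclusions close up: \<open>N(I - S_T)\<close> lies in \<open>H_i'\<close>,
    this in \<open>N(I - S_T')\<close>, and this in \<open>N(I - S_T)\<close>; \<open>H_i\<close>
    lies between \<open>H_i'\<close> and \<open>N(I - S_T)\<close>.\<close>
  have "reducing_isometric_part T = reducing_isometric_part T' \<and>
      reducing_isometric_part T' = null_space (\<lambda>h. h - asymptotic_limit T' h) \<and>
      null_space (\<lambda>h. h - asymptotic_limit T' h) = null_space (\<lambda>h. h - asymptotic_limit T h)"
    if "reduces (null_space (\<lambda>h. h - asymptotic_limit T h)) T'"
    using null_space_asymptotic_limit_harnack[OF assms that] part(3)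
      null_space_asymptotic_limit_mono[OF assms(1,2,4)]
      reducing_isometric_part_subset_null_space[OF assms(1)]
      reducing_isometric_part_subset_null_space[OF assms(2)]
    by blast
  moreover have "reducing_isometric_part T = reducing_isometric_part T'" if "harnack_equivalent T T'"
    using reducing_isometric_part_harnack(3)[OF assms(2,1) assms(3)[symmetric]] that part(3)
    by (auto simp: harnack_equivalent_def)
  ultimately show ?thesis
    using part by simp
qed

end
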